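(* Let $n\ge2$ and let $(m_{i,j})_{0\le i,j\le n}$ be the change of basis matrix from the shifted Legendre polynomials to the Bernstein polynomials, i.e. $P_j^*(x)=\sum_{i=0}^n m_{i,j}\,b_i^n(x)$. Then for every row index $0\le i\le n$ and every $0\le j\le n-2$, $$(1+j)(2+j+n)\,m_{i,j}-(3+2j)(2i-n)\,m_{i,j+1}-(2+j)(1+j-n)\,m_{i,j+2}=0.$$
   Context: $P_j^*(x)=P_j(2x-1)$ where $P_j$ is the Legendre polynomial; $b_i^n(x)=\binom{n}{i}x^i(1-x)^{n-i}$. *)

theory Defs
  imports "HOL-Analysis.Analysis" "HOL-Computational_Algebra.Polynomial"
begin

(* Rodrigues' formula, i.e. the standard normalisation P_j(1) = 1. *)
definition legendre_poly :: "nat \<Rightarrow> real poly" where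
  "legendre_poly j = smult (1 / (2 ^ j * fact j)) ((pderiv ^^ j) ([:-1, 0, 1:] ^ j))"

definition shifted_legendre :: "nat \<Rightarrow> real \<Rightarrow> real" where
  "shifted_legendre j x = poly (legendre_poly j) (2 * x - 1)"

definition legendre_bernstein_matrix :: "nat \<Rightarrow> (nat \<Rightarrow> nat \<Rightarrow> real) \<Rightarrow> bool" where
  "legendre_bernstein_matrix n m \<longleftrightarrow>
     (\<forall>j\<le>n. \<forall>x. shifted_legendre j x = (\<Sum>i=0..n. m i j * Bernstein n i x))"

end

theory Submission
  imports Defs
begin

text \<open>
  Each row relation is the coefficient of one Bernstein polynomial in a single identity between
  polynomials, so it suffices to find that identity and to know that Bernstein polynomials are
  linearly independent.

  The bridge is the equation \<open>x (1 - x) b' = (i - n x) b\<close> for \<open>b = Bernstein n i\<close>: it turns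
  multiplication of the Bernstein coefficients by \<open>2 i - n\<close> into the differential operator
  \<open>(1 - t\<^sup>2) d/dt + n t\<close> in the variable \<open>t = 2 x - 1\<close>
  (\<open>Bernstein_index_operator\<close>). Writing \<open>P k\<close> for the Legendre polynomials,
  the three families of terms then add up to
  \<open>(j + 1) (j + 2) (P j - P (j + 2)) - (2 j + 3) (1 - t\<^sup>2) P' (j + 1)\<close>
  plus \<open>n\<close> times
  \<open>(j + 2) P (j + 2) - (2 j + 3) t P (j + 1) + (j + 1) P j\<close>.
  Both expressions vanish: the second is Bonnet's recursion (\<open>legendre_Bonnet\<close>) and the first is
  a classical derivative formula (\<open>legendre_one_minus_X2_pderiv\<close>).

  These two follow from Rodrigues' formula alone. Differentiating a power of \<open>t\<^sup>2 - 1\<close> once or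
  twice before applying the remaining derivatives gives two expressions for derivatives
  of Legendre polynomials (\<open>legendre_pderiv_Suc\<close> and \<open>legendre_pderiv_diff\<close>), and the rest is
  elimination.
\<close>

section \<open>Derivative relations between Legendre polynomials\<close>

text \<open>Leibniz' rule has only two terms here, because the second derivative of \<open>[:0, 1:]\<close> is zero.\<close>
lemma higher_pderiv_X_mult:
  "(pderiv ^^ Suc k) ([:0, 1:] * p) =
     [:0, 1:] * (pderiv ^^ Suc k) p + smult (of_nat (Suc k)) ((pderiv ^^ k) p)"
  for p :: "real poly"
proof (induction k)
  case 0
  show ?case by (simp add: pderiv_mult pderiv_pCons)
next
  case (Suc k)
  let ?D = "\<lambda>k. (pderiv ^^ k) p"
  have "(pderiv ^^ Suc (Suc k)) ([:0, 1:] * p)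
      = pderiv ([:0, 1:] * ?D (Suc k) + smult (of_nat (Suc k)) (?D k))"
    using Suc by simp
  also have "\<dots> = [:0, 1:] * ?D (Suc (Suc k)) + (smult 1 (?D (Suc k)) + smult (of_nat (Suc k)) (?D (Suc k)))"
    by (simp add: pderiv_add pderiv_smult pderiv_pCons algebra_simps del: of_nat_Suc)
  also have "smult 1 (?D (Suc k)) + smult (of_nat (Suc k)) (?D (Suc k))
      = smult (of_nat (Suc (Suc k))) (?D (Suc k))"
    unfolding smult_add_left [symmetric] by (simp only: of_nat_Suc)
  finally show ?case .
qed

lemma pderiv_power_X2_minus_1:
  "pderiv ([:-1, 0, 1:] ^ Suc k :: real poly) =
     smult (2 * of_nat (Suc k)) ([:0, 1:] * [:-1, 0, 1:] ^ k)"
proof -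
  have "pderiv ([:-1, 0, 1:] :: real poly) = smult 2 [:0, 1:]"
    by (simp add: pderiv_pCons)
  then show ?thesis
    by (simp only: pderiv_power_Suc mult_smult_left mult_smult_right smult_smult mult_ac)
qed

text \<open>
  The second derivative first yields a term with \<open>t\<^sup>2 (t\<^sup>2 - 1)^k\<close>; replacing its \<open>t\<^sup>2\<close> by
  \<open>(t\<^sup>2 - 1) + 1\<close> leaves only pure powers of \<open>t\<^sup>2 - 1\<close>, the form to which Rodrigues' formula
  applies again.
\<close>
lemma pderiv2_power_X2_minus_1:
  "pderiv (pderiv ([:-1, 0, 1:] ^ Suc (Suc k) :: real poly)) =
     smult (2 * of_nat (k + 2) * of_nat (2 * k + 3)) ([:-1, 0, 1:] ^ Suc k)
     + smult (2 * of_nat (k + 2) * (2 * of_nat (k + 1))) ([:-1, 0, 1:] ^ k)"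
proof -
  have "poly (pderiv (pderiv ([:-1, 0, 1:] ^ Suc (Suc k) :: real poly))) x = poly (
     smult (2 * of_nat (k + 2) * of_nat (2 * k + 3)) ([:-1, 0, 1:] ^ Suc k)
     + smult (2 * of_nat (k + 2) * (2 * of_nat (k + 1))) ([:-1, 0, 1:] ^ k)) x" for x
    unfolding pderiv_power_X2_minus_1 pderiv_smult pderiv_mult
    by (simp add: pderiv_pCons algebra_simps)
  then show ?thesis
    by (simp add: poly_eq_poly_eq_iff [symmetric] fun_eq_iff)
qed

text \<open>
  Rodrigues' formula with one of the derivatives moved inside: it produces \<open>t (t\<^sup>2 - 1)^k\<close>, whose
  remaining derivatives are given by the two-term Leibniz rule.
\<close>
lemma legendre_pderiv_Suc:
  "pderiv (legendre_poly (Suc k)) =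
     [:0, 1:] * pderiv (legendre_poly k) + smult (of_nat (Suc k)) (legendre_poly k)"
proof -
  let ?w = "[:-1, 0, 1:] :: real poly"
  have "pderiv ((pderiv ^^ Suc k) (?w ^ Suc k)) = (pderiv ^^ Suc k) (pderiv (?w ^ Suc k))"
    by (metis funpow_swap1)
  also have "\<dots> = smult (2 * of_nat (Suc k)) ([:0, 1:] * (pderiv ^^ Suc k) (?w ^ k)
      + smult (of_nat (Suc k)) ((pderiv ^^ k) (?w ^ k)))"
    unfolding pderiv_power_X2_minus_1 higher_pderiv_smult higher_pderiv_X_mult ..
  finally have eq: "pderiv ((pderiv ^^ Suc k) (?w ^ Suc k)) = \<dots>" .
  have "(1 / (2 ^ Suc k * fact (Suc k))) * (2 * of_nat (Suc k)) = (1 / (2 ^ k * fact k) :: real)"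
    by (simp add: divide_simps del: of_nat_Suc)
  then show ?thesis
    unfolding legendre_poly_def pderiv_smult eq smult_smult
    by (simp add: smult_add_right mult_ac del: of_nat_Suc)
qed

text \<open>Rodrigues' formula with two of the derivatives moved inside.\<close>
lemma legendre_pderiv_diff:
  "pderiv (legendre_poly (Suc (Suc k))) =
     pderiv (legendre_poly k) + smult (of_nat (2 * k + 3)) (legendre_poly (Suc k))"
proof -
  let ?w = "[:-1, 0, 1:] :: real poly"
  have "pderiv ((pderiv ^^ Suc (Suc k)) (?w ^ Suc (Suc k)))
      = (pderiv ^^ Suc k) (pderiv (pderiv (?w ^ Suc (Suc k))))"
    by (metis funpow.simps(2) funpow_swap1 o_apply)
  also have "\<dots> = 
     smult (2 * of_nat (k + 2) * of_nat (2 * k + 3)) ((pderiv ^^ Suc k) (?w ^ Suc k))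
     + smult (2 * of_nat (k + 2) * (2 * of_nat (k + 1))) (pderiv ((pderiv ^^ k) (?w ^ k)))"
    unfolding pderiv2_power_X2_minus_1 higher_pderiv_smult higher_pderiv_add by simp
  finally have eq: "pderiv ((pderiv ^^ Suc (Suc k)) (?w ^ Suc (Suc k))) = \<dots>" .
  have c1: "(1 / (2 ^ Suc (Suc k) * fact (Suc (Suc k)))) * (2 * of_nat (k + 2) * of_nat (2 * k + 3))
      = (of_nat (2 * k + 3) * (1 / (2 ^ Suc k * fact (Suc k))) :: real)"
    by (simp add: divide_simps) (simp add: algebra_simps)
  have c2: "(1 / (2 ^ Suc (Suc k) * fact (Suc (Suc k)))) * (2 * of_nat (k + 2) * (2 * of_nat (k + 1)))
      = (1 / (2 ^ k * fact k) :: real)"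
    by (simp add: divide_simps) (simp add: algebra_simps)
  show ?thesis
    unfolding legendre_poly_def pderiv_smult eq smult_add_right smult_smult c1 c2
    by (simp add: add.commute)
qed

section \<open>Three-term relations at a point\<close>

text \<open>
  The two derivative relations together also give the lowering counterpart of
  \<open>legendre_pderiv_Suc\<close>. Multiplying that counterpart by \<open>x\<close> and subtracting
  \<open>legendre_pderiv_Suc\<close> eliminates the derivative of the lower polynomial.
\<close>
lemma legendre_X2_minus_1_pderiv:
  "(x\<^sup>2 - 1) * poly (pderiv (legendre_poly (Suc k))) x =
     real (Suc k) * (x * poly (legendre_poly (Suc k)) x - poly (legendre_poly k) x)"
proof -
  let ?P = "\<lambda>j. poly (legendre_poly j) x"
  let ?D = "\<lambda>j. poly (pderiv (legendre_poly j)) x"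
  have up: "?D (Suc j) = x * ?D j + real (Suc j) * ?P j" for j
    by (simp add: legendre_pderiv_Suc)
  have "?D (Suc (Suc k)) = ?D k + real (2 * k + 3) * ?P (Suc k)"
    by (simp add: legendre_pderiv_diff)
  then have down: "x * ?D (Suc k) = ?D k + real (Suc k) * ?P (Suc k)"
    using up [of "Suc k"] by (simp add: algebra_simps)
  have "(x\<^sup>2 - 1) * ?D (Suc k) = x * (x * ?D (Suc k)) - ?D (Suc k)"
    by (simp add: algebra_simps power2_eq_square)
  also have "\<dots> = x * (?D k + real (Suc k) * ?P (Suc k)) - (x * ?D k + real (Suc k) * ?P k)"
    by (simp only: down) (simp only: up)
  also have "\<dots> = real (Suc k) * (x * ?P (Suc k) - ?P k)"
    by (simp add: algebra_simps)
  finally show ?thesis .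
qed

text \<open>
  Expanding \<open>(x\<^sup>2 - 1) P' (k + 2)\<close> in two ways, by the previous lemma directly and through
  \<open>legendre_pderiv_Suc\<close>, gives the recursion multiplied by \<open>x\<close>. The factor \<open>x\<close> may be zero
  at a point, so it is cancelled in the polynomial ring, which is an integral domain.
\<close>
lemma legendre_Bonnet:
  "real (k + 2) * poly (legendre_poly (Suc (Suc k))) x =
     real (2 * k + 3) * x * poly (legendre_poly (Suc k)) x - real (k + 1) * poly (legendre_poly k) x"
proof -
  define q where "q = smult (real (k + 2)) (legendre_poly (Suc (Suc k)))
    - smult (real (2 * k + 3)) ([:0, 1:] * legendre_poly (Suc k))
    + smult (real (k + 1)) (legendre_poly k)"
  have "poly ([:0, 1:] * q) y = poly 0 y" for y
  proof -
    let ?P = "\<lambda>j. poly (legendre_poly j) y"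
    let ?D = "\<lambda>j. poly (pderiv (legendre_poly j)) y"
    have "real (k + 2) * (y * ?P (Suc (Suc k)) - ?P (Suc k)) = (y\<^sup>2 - 1) * ?D (Suc (Suc k))"
      using legendre_X2_minus_1_pderiv [of y "Suc k"] by simp
    also have "\<dots> = y * ((y\<^sup>2 - 1) * ?D (Suc k)) + (y\<^sup>2 - 1) * real (k + 2) * ?P (Suc k)"
      by (simp add: legendre_pderiv_Suc algebra_simps)
    also have "\<dots> = y * (real (k + 1) * (y * ?P (Suc k) - ?P k))
        + (y\<^sup>2 - 1) * real (k + 2) * ?P (Suc k)"
      unfolding legendre_X2_minus_1_pderiv by simp
    finally show ?thesis
      by (simp add: q_def algebra_simps power2_eq_square)
  qed
  then have "[:0, 1:] * q = 0"
    by (metis poly_eq_poly_eq_iff ext)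
  then have "q = 0"
    by simp
  then have "poly q x = 0"
    by simp
  then show ?thesis
    by (simp add: q_def algebra_simps)
qed

text \<open>Bonnet's recursion removes the factor \<open>x\<close> from the right-hand side of
  \<open>legendre_X2_minus_1_pderiv\<close>.\<close>
lemma legendre_one_minus_X2_pderiv:
  "real (2 * k + 3) * ((1 - x\<^sup>2) * poly (pderiv (legendre_poly (Suc k))) x) =
     real ((k + 1) * (k + 2)) * (poly (legendre_poly k) x - poly (legendre_poly (Suc (Suc k))) x)"
proof -
  let ?P = "\<lambda>j. poly (legendre_poly j) x"
  let ?D = "poly (pderiv (legendre_poly (Suc k))) x"
  have "real (2 * k + 3) * ((1 - x\<^sup>2) * ?D) = - (real (2 * k + 3) * ((x\<^sup>2 - 1) * ?D))"
    by (simp add: algebra_simps)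
  also have "\<dots> = - real (k + 1) * (real (2 * k + 3) * x * ?P (Suc k) - real (2 * k + 3) * ?P k)"
    unfolding legendre_X2_minus_1_pderiv by (simp add: algebra_simps)
  also have "\<dots> = - real (k + 1) *
      (real (k + 2) * ?P (Suc (Suc k)) + real (k + 1) * ?P k - real (2 * k + 3) * ?P k)"
    using legendre_Bonnet [of k x] by simp
  also have "\<dots> = real ((k + 1) * (k + 2)) * (?P k - ?P (Suc (Suc k)))"
    by (simp add: algebra_simps)
  finally show ?thesis .
qed

section \<open>The Bernstein basis\<close>

text \<open>
  The substitution \<open>x = y / (1 + y)\<close> followed by multiplication by \<open>(1 + y)^n\<close> turns the Bernstein
  polynomials into multiples of the monomials \<open>y^i\<close>, so a vanishing combination becomes an
  ordinary polynomial that is zero for every \<open>y\<close> other than \<open>-1\<close>.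
\<close>
lemma Bernstein_sum_eq_0_imp_coeff_eq_0:
  assumes "\<And>x. (\<Sum>i=0..n. c i * Bernstein n i x) = 0" and "i \<le> n"
  shows "c i = 0"
proof -
  have root: "(\<Sum>i\<le>n. (c i * real (n choose i)) * y ^ i) = 0" if "y \<noteq> -1" for y :: real
  proof -
    define x where "x = y / (1 + y)"
    have y: "1 + y \<noteq> 0" using that by (simp add: add_eq_0_iff)
    have x': "1 - x = 1 / (1 + y)" using y by (simp add: x_def field_simps)
    have "(1 + y) ^ n * Bernstein n i x = real (n choose i) * y ^ i" if "i \<le> n" for i
    proof -
      have "(1 + y) ^ n = (1 + y) ^ i * (1 + y) ^ (n - i)"
        using that by (simp flip: power_add)
      then show ?thesis
        using y unfolding Bernstein_def x' by (simp add: x_def power_divide)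
    qed
    then have "(\<Sum>i\<le>n. (c i * real (n choose i)) * y ^ i)
        = (\<Sum>i\<le>n. c i * ((1 + y) ^ n * Bernstein n i x))"
      by (intro sum.cong) auto
    also have "\<dots> = (1 + y) ^ n * (\<Sum>i=0..n. c i * Bernstein n i x)"
      by (simp add: sum_distrib_left atMost_atLeast0 mult_ac)
    finally show ?thesis using assms(1) by simp
  qed
  have "infinite (UNIV - {-1 :: real})"
    by (simp add: infinite_UNIV_char_0)
  moreover have "UNIV - {-1} \<subseteq> {y. (\<Sum>i\<le>n. (c i * real (n choose i)) * y ^ i) = 0}"
    using root by auto
  ultimately have "infinite {y. (\<Sum>i\<le>n. (c i * real (n choose i)) * y ^ i) = 0}"
    using finite_subset by blast
  then have "c i * real (n choose i) = 0"
    unfolding polyfun_finite_roots using \<open>i \<le> n\<close> by blast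
  then show ?thesis
    using \<open>i \<le> n\<close> by simp
qed

lemma Bernstein_has_real_derivative:
  assumes "i \<le> n"
  shows "\<exists>d. (Bernstein n i has_real_derivative d) (at x) \<and>
    x * (1 - x) * d = (real i - real n * x) * Bernstein n i x"
proof (intro exI conjI)
  let ?d = "real (n choose i) * (real i * x ^ (i - 1) * (1 - x) ^ (n - i)
    - x ^ i * (real (n - i) * (1 - x) ^ (n - i - 1)))"
  show "(Bernstein n i has_real_derivative ?d) (at x)"
    unfolding Bernstein_def by (auto intro!: derivative_eq_intros simp: algebra_simps)
  \<comment> \<open>absorbs the truncated exponents, the case of exponent \<open>0\<close> included\<close>
  have lower: "y * (real k * y ^ (k - 1)) = real k * y ^ k" for y k
    by (cases k) auto
  have "x * (1 - x) * ?d = real (n choose i) * ((1 - x) * (1 - x) ^ (n - i) * (x * (real i * x ^ (i - 1)))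
    - x * x ^ i * ((1 - x) * (real (n - i) * (1 - x) ^ (n - i - 1))))"
    by (simp add: algebra_simps)
  also have "\<dots> = (real i - real n * x) * Bernstein n i x"
    unfolding lower Bernstein_def using assms by (simp add: of_nat_diff algebra_simps)
  finally show "x * (1 - x) * ?d = (real i - real n * x) * Bernstein n i x" .
qed

text \<open>
  In terms of \<open>t = 2 x - 1\<close> the operator \<open>x (1 - x) d/dx\<close> is \<open>(1 - t\<^sup>2) / 2\<close> times \<open>d/dt\<close>, and it
  multiplies the summand of index \<open>i\<close> by \<open>i - n x\<close>, where \<open>2 (i - n x) = (2 i - n) - n t\<close>.
\<close>
lemma Bernstein_index_operator:
  assumes p: "\<And>x. poly p (2 * x - 1) = (\<Sum>i=0..n. c i * Bernstein n i x)"
  shows "(\<Sum>i=0..n. (2 * real i - real n) * c i * Bernstein n i x) =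
    (1 - (2 * x - 1)\<^sup>2) * poly (pderiv p) (2 * x - 1) + real n * (2 * x - 1) * poly p (2 * x - 1)"
proof -
  obtain d where d: "\<And>i. i \<le> n \<Longrightarrow> (Bernstein n i has_real_derivative d i) (at x)"
    "\<And>i. i \<le> n \<Longrightarrow> x * (1 - x) * d i = (real i - real n * x) * Bernstein n i x"
    using Bernstein_has_real_derivative [of _ n x] by metis
  have "((\<lambda>x. \<Sum>i=0..n. c i * Bernstein n i x) has_real_derivative (\<Sum>i=0..n. c i * d i)) (at x)"
    by (intro DERIV_sum DERIV_cmult d(1)) simp
  moreover have "((\<lambda>x. poly p (2 * x - 1)) has_real_derivative 2 * poly (pderiv p) (2 * x - 1)) (at x)"
    by (auto intro!: derivative_eq_intros)
  ultimately have "2 * poly (pderiv p) (2 * x - 1) = (\<Sum>i=0..n. c i * d i)"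
    unfolding p by (rule DERIV_unique [rotated])
  then have "2 * x * (1 - x) * (2 * poly (pderiv p) (2 * x - 1)) =
      2 * x * (1 - x) * (\<Sum>i=0..n. c i * d i)"
    by simp
  then have "(1 - (2 * x - 1)\<^sup>2) * poly (pderiv p) (2 * x - 1) =
      2 * x * (1 - x) * (\<Sum>i=0..n. c i * d i)"
    by (simp add: algebra_simps power2_eq_square)
  also have "\<dots> = (\<Sum>i=0..n. 2 * c i * (x * (1 - x) * d i))"
    by (simp add: sum_distrib_left mult_ac)
  also have "\<dots> = (\<Sum>i=0..n. 2 * c i * ((real i - real n * x) * Bernstein n i x))"
    by (intro sum.cong) (simp_all add: d(2))
  finally show ?thesis
    by (simp add: p sum_distrib_left flip: sum.distrib) (simp add: algebra_simps)
qed

section \<open>The recurrence along the rows\<close>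

theorem mainTheorem11:
  fixes n :: nat and m :: "nat \<Rightarrow> nat \<Rightarrow> real"
  assumes "n \<ge> 2"
    and "legendre_bernstein_matrix n m"
  shows "\<forall>i\<le>n. \<forall>j\<le>n - 2.
    (1 + real j) * (2 + real j + real n) * m i j
    - (3 + 2 * real j) * (2 * real i - real n) * m i (j + 1)
    - (2 + real j) * (1 + real j - real n) * m i (j + 2) = 0"
proof (intro allI impI)
  fix i j assume i: "i \<le> n" and j: "j \<le> n - 2"
  let ?P = "\<lambda>k x. poly (legendre_poly k) (2 * x - 1)"
  have P: "?P k x = (\<Sum>i=0..n. m i k * Bernstein n i x)" if "k \<le> n" for k x
    using assms(2) that by (simp add: legendre_bernstein_matrix_def shifted_legendre_def)
  let ?r = "\<lambda>i. (1 + real j) * (2 + real j + real n) * m i j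
    - (3 + 2 * real j) * (2 * real i - real n) * m i (j + 1)
    - (2 + real j) * (1 + real j - real n) * m i (j + 2)"
  have "(\<Sum>i=0..n. ?r i * Bernstein n i x) = 0" for x
  proof -
    define t where "t = 2 * x - 1"
    let ?Q = "\<lambda>k. poly (legendre_poly k) t"
    let ?D = "poly (pderiv (legendre_poly (j + 1))) t"
    have "(\<Sum>i=0..n. ?r i * Bernstein n i x) =
        (1 + real j) * (2 + real j + real n) * (\<Sum>i=0..n. m i j * Bernstein n i x)
        - (3 + 2 * real j) * (\<Sum>i=0..n. (2 * real i - real n) * m i (j + 1) * Bernstein n i x)
        - (2 + real j) * (1 + real j - real n) * (\<Sum>i=0..n. m i (j + 2) * Bernstein n i x)"
      unfolding sum_distrib_left sum_subtractf [symmetric]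
      by (intro sum.cong) (simp_all add: algebra_simps)
    also have "(\<Sum>i=0..n. m i j * Bernstein n i x) = ?Q j"
      using P [of j x] j by (simp add: t_def)
    also have "(\<Sum>i=0..n. m i (j + 2) * Bernstein n i x) = ?Q (j + 2)"
      using P [of "j + 2" x] j \<open>n \<ge> 2\<close> by (simp add: t_def)
    also have "(\<Sum>i=0..n. (2 * real i - real n) * m i (j + 1) * Bernstein n i x)
        = (1 - t\<^sup>2) * ?D + real n * t * ?Q (j + 1)"
      unfolding t_def using j \<open>n \<ge> 2\<close> by (intro Bernstein_index_operator P) simp
    \<comment> \<open>grouping by powers of \<open>n\<close>: the constant part is the derivative formula, the linear part
      is Bonnet's recursion\<close>
    also have "(1 + real j) * (2 + real j + real n) * ?Q j
        - (3 + 2 * real j) * ((1 - t\<^sup>2) * ?D + real n * t * ?Q (j + 1))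
        - (2 + real j) * (1 + real j - real n) * ?Q (j + 2)
      = (real ((j + 1) * (j + 2)) * (?Q j - ?Q (j + 2)) - real (2 * j + 3) * ((1 - t\<^sup>2) * ?D))
        + real n * (real (j + 2) * ?Q (j + 2)
          - (real (2 * j + 3) * t * ?Q (j + 1) - real (j + 1) * ?Q j))"
      by (simp add: algebra_simps)
    also have "\<dots> = 0"
      using legendre_one_minus_X2_pderiv [of j t] legendre_Bonnet [of j t] by simp
    finally show ?thesis .
  qed
  then show "?r i = 0"
    using i by (rule Bernstein_sum_eq_0_imp_coeff_eq_0)
qed

end
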